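(* Let $\delta\in\mathbb C^\times$, let $(\mathcal A,\ast,\circ)$ be a $\delta$-mock-Novikov-Poisson algebra over $\mathbb C$, and fix $u\in\mathcal A$. Let $\kappa_u=K_u(\ast,\circ)$ be the Kantor product of $\ast$ and $\circ$ with respect to $u$, i.e. $$\kappa_u(x,y)=u\ast(x\circ y)-(u\ast x)\circ y-x\circ(u\ast y),\qquad x,y\in\mathcal A.$$ Then $(\mathcal A,\kappa_u)$ is a $\delta$-mock-Novikov algebra. Moreover, $$\kappa_u\bigl(\kappa_u(x,y),z\bigr)=0\qquad\text{for all }x,y,z\in\mathcal A.$$
   Context: The ground field is $\mathbb C$; an algebra is a vector space with a bilinear product, not necessarily associative. A $\delta$-mock-Novikov algebra is an algebra $(\mathcal A,\circ)$ such that for all $a,b,c\in\mathcal A$ $$\delta(a\circ b)\circ c+\delta(b\circ a)\circ c+a\circ(b\circ c)+b\circ(a\circ c)=0,\qquad (a\circ b)\circ c+(a\circ c)\circ b=0.$$ A $\delta$-mock-Novikov-Poisson algebra is a triple $(\mathcal A,\ast,\circ)$ where $(\mathcal A,\ast)$ is anti-commutative ($x\ast y=-y\ast x$) and anti-associative ($(x\ast y)\ast z=-x\ast(y\ast z)$), $(\mathcal A,\circ)$ is a $\delta$-mock-Novikov algebra, and for all $x,y,z\in\mathcal A$ $$(x\ast y)\circ z+x\ast(y\circ z)=0,$$ $$\delta(x\circ y)\ast z+\delta(y\circ x)\ast z+x\circ(y\ast z)+y\circ(x\ast z)=0.$$ The Kantor product of two bilinear multiplications $A,B$ with respect to a fixed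 element $u$ is $K_u(A,B)(x,y)=A(u,B(x,y))-B(A(u,x),y)-B(x,A(u,y))$. *)

theory Defs
  imports Complex_Main
begin

locale complex_algebra = vector_space scale
  for scale :: "complex \<Rightarrow> 'a::ab_group_add \<Rightarrow> 'a" (infixr "*s" 75) +
  fixes mult :: "'a \<Rightarrow> 'a \<Rightarrow> 'a"
  assumes linear_left: "Vector_Spaces.linear scale scale (\<lambda>x. mult x y)"
    and linear_right: "Vector_Spaces.linear scale scale (\<lambda>y. mult x y)"

locale mock_Novikov_algebra = complex_algebra scale circ
  for scale :: "complex \<Rightarrow> 'a::ab_group_add \<Rightarrow> 'a" (infixr "*s" 75)
    and circ :: "'a \<Rightarrow> 'a \<Rightarrow> 'a" (infixl "\<circ>\<^sub>A" 70) +
  fixes \<delta> :: complex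
  assumes delta_identity:
      "\<delta> *s ((a \<circ>\<^sub>A b) \<circ>\<^sub>A c) + \<delta> *s ((b \<circ>\<^sub>A a) \<circ>\<^sub>A c)
        + a \<circ>\<^sub>A (b \<circ>\<^sub>A c) + b \<circ>\<^sub>A (a \<circ>\<^sub>A c) = 0"
    and right_anticomm: "(a \<circ>\<^sub>A b) \<circ>\<^sub>A c + (a \<circ>\<^sub>A c) \<circ>\<^sub>A b = 0"

locale mock_Novikov_Poisson_algebra =
  star: complex_algebra scale star + mock_Novikov_algebra scale circ \<delta>
  for scale :: "complex \<Rightarrow> 'a::ab_group_add \<Rightarrow> 'a" (infixr "*s" 75)
    and star :: "'a \<Rightarrow> 'a \<Rightarrow> 'a" (infixl "\<star>\<^sub>A" 70)
    and circ :: "'a \<Rightarrow> 'a \<Rightarrow> 'a" (infixl "\<circ>\<^sub>A" 70)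
    and \<delta> :: complex +
  assumes star_anticomm: "x \<star>\<^sub>A y = - (y \<star>\<^sub>A x)"
    and star_antiassoc: "(x \<star>\<^sub>A y) \<star>\<^sub>A z = - (x \<star>\<^sub>A (y \<star>\<^sub>A z))"
    and star_circ: "(x \<star>\<^sub>A y) \<circ>\<^sub>A z + x \<star>\<^sub>A (y \<circ>\<^sub>A z) = 0"
    and delta_star_circ:
      "\<delta> *s ((x \<circ>\<^sub>A y) \<star>\<^sub>A z) + \<delta> *s ((y \<circ>\<^sub>A x) \<star>\<^sub>A z)
        + x \<circ>\<^sub>A (y \<star>\<^sub>A z) + y \<circ>\<^sub>A (x \<star>\<^sub>A z) = 0"

definition Kantor_product ::
  "'a::ab_group_add \<Rightarrow> ('a \<Rightarrow> 'a \<Rightarrow> 'a) \<Rightarrow> ('a \<Rightarrow> 'a \<Rightarrow> 'a) \<Rightarrow> 'a \<Rightarrow> 'a \<Rightarrow> 'a"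
  where "Kantor_product u A B x y = A u (B x y) - B (A u x) y - B x (A u y)"

end

theory Submission
  imports Defs
begin

text \<open>
  Comparing the two symmetries of \<open>c \<star> ((a \<circ> b) \<circ> d)\<close> in \<open>a, c\<close> (antisymmetric when
  it is read as \<open>((c \<star> a) \<circ> b) \<circ> d\<close>, symmetric when it is read as
  \<open>- (a \<circ> b) \<star> (c \<circ> d)\<close>) shows that it vanishes, and a similar sign comparison kills
  \<open>a \<star> (b \<star> (c \<circ> d))\<close>. Together with the mixed \<open>\<delta>\<close>-identity, which on the
  diagonal reads \<open>u \<circ> (u \<star> y) = - \<delta> (u \<circ> u) \<star> y\<close>, these make every term of \<open>\<kappa> (\<kappa> x y) z\<close> and of
  \<open>\<kappa> x (\<kappa> y z)\<close> zero, except \<open>- 2 u \<star> (x \<circ> (y \<circ> (u \<star> z)))\<close>, whose symmetrization in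
  \<open>x, y\<close> reduces by the \<open>\<delta>\<close>-identity of \<open>\<circ>\<close> to terms of the first kind.
\<close>

lemma (in vector_space) linear_self_iff:
  "Vector_Spaces.linear scale scale f \<longleftrightarrow>
     (\<forall>x y. f (x + y) = f x + f y) \<and> (\<forall>c x. f (scale c x) = scale c (f x))"
  using vector_space_axioms module_axioms
  by (auto simp: linear_iff_module_hom module_hom_iff)

context complex_algebra
begin

lemma mult_add_left: "mult (x + y) z = mult x z + mult y z"
  and mult_scale_left: "mult (c *s x) z = c *s mult x z"
  using linear_left by (auto simp: linear_self_iff)

lemma mult_add_right: "mult z (x + y) = mult z x + mult z y"
  and mult_scale_right: "mult z (c *s x) = c *s mult z x"
  using linear_right by (auto simp: linear_self_iff)

lemma mult_zero_left [simp]: "mult 0 z = 0"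
  and mult_zero_right [simp]: "mult z 0 = 0"
  using mult_add_left[of 0 0 z] mult_add_right[of z 0 0] by simp_all

lemma mult_minus_left: "mult (- x) z = - mult x z"
  using mult_add_left[of "- x" x z] by (simp add: eq_neg_iff_add_eq_0)

lemma mult_minus_right: "mult z (- x) = - mult z x"
  using mult_add_right[of z "- x" x] by (simp add: eq_neg_iff_add_eq_0)

lemma mult_diff_left: "mult (x - y) z = mult x z - mult y z"
  using mult_add_left[of x "- y" z] by (simp add: mult_minus_left)

lemma mult_diff_right: "mult z (x - y) = mult z x - mult z y"
  using mult_add_right[of z x "- y"] by (simp add: mult_minus_right)

text \<open>The scalar 2 is invertible in the ground field. The sign comparisons below only yield
  \<open>v = - v\<close>, and this is what turns them into vanishing.\<close>

lemma double_eq_0D: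
  fixes v :: 'a
  assumes "v + v = 0"
  shows "v = 0"
proof -
  have "2 *s v = 0"
    using assms scale_left_distrib[of 1 1 v] by simp
  then show ?thesis by simp
qed

lemma eq_minus_selfD:
  fixes v :: 'a
  shows "v = - v \<Longrightarrow> v = 0"
  using double_eq_0D[of v] by (simp add: eq_neg_iff_add_eq_0)

end

lemma complex_algebra_Kantor_product:
  assumes "complex_algebra scale A" and "complex_algebra scale B"
  shows "complex_algebra scale (Kantor_product u A B)"
proof -
  interpret A: complex_algebra scale A by fact
  interpret B: complex_algebra scale B by fact
  show ?thesis
    by unfold_locales
      (simp_all add: A.linear_self_iff Kantor_product_def algebra_simps
        A.mult_add_left A.mult_scale_left A.mult_add_right A.mult_scale_right
        B.mult_add_left B.mult_scale_left B.mult_add_right B.mult_scale_right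
        A.scale_right_diff_distrib)
qed

context mock_Novikov_Poisson_algebra
begin

lemma right_anticomm': "(a \<circ>\<^sub>A b) \<circ>\<^sub>A c = - ((a \<circ>\<^sub>A c) \<circ>\<^sub>A b)"
  using right_anticomm[of a b c] by (simp add: eq_neg_iff_add_eq_0)

lemma star_circ': "(x \<star>\<^sub>A y) \<circ>\<^sub>A z = - (x \<star>\<^sub>A (y \<circ>\<^sub>A z))"
  using star_circ[of x y z] by (simp add: eq_neg_iff_add_eq_0)

text \<open>Both products are readings of \<open>(x \<star> y) \<circ> z\<close> up to sign, which
  is antisymmetric in \<open>x\<close>, \<open>y\<close>.\<close>

lemma star_circ_swap: "x \<star>\<^sub>A (y \<circ>\<^sub>A z) = - (y \<star>\<^sub>A (x \<circ>\<^sub>A z))"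
  using star_circ'[of x y z] star_circ'[of y x z] star_anticomm[of x y]
  by (simp add: mult_minus_left)

lemma star_swap: "x \<star>\<^sub>A (y \<star>\<^sub>A z) = - (y \<star>\<^sub>A (x \<star>\<^sub>A z))"
  using star_antiassoc[of x y z] star_antiassoc[of y x z] star_anticomm[of x y]
  by (simp add: star.mult_minus_left)

lemma star_circ_circ [simp]: "c \<star>\<^sub>A ((a \<circ>\<^sub>A b) \<circ>\<^sub>A d) = 0"
proof -
  have sym: "c \<star>\<^sub>A ((a \<circ>\<^sub>A b) \<circ>\<^sub>A d) = a \<star>\<^sub>A ((c \<circ>\<^sub>A b) \<circ>\<^sub>A d)"
  proof -
    have "c \<star>\<^sub>A ((a \<circ>\<^sub>A b) \<circ>\<^sub>A d) = - ((a \<circ>\<^sub>A b) \<star>\<^sub>A (c \<circ>\<^sub>A d))"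
      by (rule star_circ_swap)
    also have "\<dots> = (c \<circ>\<^sub>A d) \<star>\<^sub>A (a \<circ>\<^sub>A b)"
      using star_anticomm[of "a \<circ>\<^sub>A b" "c \<circ>\<^sub>A d"] by simp
    also have "\<dots> = - (a \<star>\<^sub>A ((c \<circ>\<^sub>A d) \<circ>\<^sub>A b))"
      by (rule star_circ_swap)
    also have "\<dots> = a \<star>\<^sub>A ((c \<circ>\<^sub>A b) \<circ>\<^sub>A d)"
      using right_anticomm'[of c d b] by (simp add: star.mult_minus_right)
    finally show ?thesis .
  qed
  have read: "((c \<star>\<^sub>A a) \<circ>\<^sub>A b) \<circ>\<^sub>A d = c \<star>\<^sub>A ((a \<circ>\<^sub>A b) \<circ>\<^sub>A d)" for a c
    by (simp add: star_circ' mult_minus_left)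
  have "c \<star>\<^sub>A ((a \<circ>\<^sub>A b) \<circ>\<^sub>A d) = - (a \<star>\<^sub>A ((c \<circ>\<^sub>A b) \<circ>\<^sub>A d))"
    using read[of c a] read[of a c] star_anticomm[of c a] by (simp add: mult_minus_left)
  then show ?thesis
    using sym eq_minus_selfD by metis
qed

lemma circ_star_circ [simp]: "(a \<circ>\<^sub>A b) \<star>\<^sub>A (c \<circ>\<^sub>A d) = 0"
  using star_circ_swap[of "a \<circ>\<^sub>A b" c d] by simp

lemma star_star_circ [simp]: "a \<star>\<^sub>A (b \<star>\<^sub>A (c \<circ>\<^sub>A d)) = 0"
proof -
  \<comment> \<open>The chain carries \<open>c\<close> to the front and back to its place, picking
    up an odd number of signs in total.\<close>
  have "a \<star>\<^sub>A (b \<star>\<^sub>A (c \<circ>\<^sub>A d)) = - ((a \<star>\<^sub>A b) \<star>\<^sub>A (c \<circ>\<^sub>A d))"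
    by (simp add: star_antiassoc)
  also have "\<dots> = c \<star>\<^sub>A ((a \<star>\<^sub>A b) \<circ>\<^sub>A d)"
    using star_circ_swap[of "a \<star>\<^sub>A b" c d] by simp
  also have "\<dots> = - (c \<star>\<^sub>A (a \<star>\<^sub>A (b \<circ>\<^sub>A d)))"
    by (simp add: star_circ' star.mult_minus_right)
  also have "\<dots> = a \<star>\<^sub>A (c \<star>\<^sub>A (b \<circ>\<^sub>A d))"
    using star_swap[of c a] by simp
  also have "\<dots> = - (a \<star>\<^sub>A (b \<star>\<^sub>A (c \<circ>\<^sub>A d)))"
    using star_circ_swap[of c b d] by (simp add: star.mult_minus_right)
  finally show ?thesis by (rule eq_minus_selfD)
qed

lemma star_circ_star [simp]: "a \<star>\<^sub>A ((c \<circ>\<^sub>A d) \<star>\<^sub>A b) = 0"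
  using star_anticomm[of "c \<circ>\<^sub>A d" b] by (simp add: star.mult_minus_right)

lemma circ_star_diag: "u \<circ>\<^sub>A (u \<star>\<^sub>A y) = - (\<delta> *s ((u \<circ>\<^sub>A u) \<star>\<^sub>A y))"
proof -
  have "(\<delta> *s ((u \<circ>\<^sub>A u) \<star>\<^sub>A y) + u \<circ>\<^sub>A (u \<star>\<^sub>A y))
      + (\<delta> *s ((u \<circ>\<^sub>A u) \<star>\<^sub>A y) + u \<circ>\<^sub>A (u \<star>\<^sub>A y)) = 0"
    using delta_star_circ[of u u y] by (simp add: algebra_simps)
  from double_eq_0D[OF this] show ?thesis
    by (simp add: eq_neg_iff_add_eq_0 add.commute)
qed

lemma star_circ_star_diag [simp]: "u \<star>\<^sub>A (x \<circ>\<^sub>A (u \<star>\<^sub>A y)) = 0"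
  \<comment> \<open>Swapping \<open>u\<close> and \<open>x\<close> exposes
    \<open>u \<circ> (u \<star> y)\<close>, a multiple of \<open>(u \<circ> u) \<star> y\<close>,
    which \<open>star_circ_star\<close> kills under \<open>x \<star>\<close>.\<close>
  using star_circ_swap[of u x "u \<star>\<^sub>A y"]
  by (simp add: circ_star_diag star.mult_minus_right star.mult_scale_right)

lemma circ_star_circ_star_diag [simp]: "(x \<circ>\<^sub>A (u \<star>\<^sub>A z)) \<circ>\<^sub>A (u \<star>\<^sub>A y) = 0"
proof -
  \<comment> \<open>The mixed identity exchanges \<open>x\<close> and \<open>u\<close>; the
    \<delta>-terms then die under right multiplication by \<open>circ_star_circ\<close>.\<close>
  have "x \<circ>\<^sub>A (u \<star>\<^sub>A z) =
      - (\<delta> *s ((x \<circ>\<^sub>A u) \<star>\<^sub>A z) + \<delta> *s ((u \<circ>\<^sub>A x) \<star>\<^sub>A z) + u \<circ>\<^sub>A (x \<star>\<^sub>A z))"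
    using delta_star_circ[of x u z]
    by (simp add: eq_neg_iff_add_eq_0 algebra_simps)
  then have "(x \<circ>\<^sub>A (u \<star>\<^sub>A z)) \<circ>\<^sub>A (u \<star>\<^sub>A y) = - ((u \<circ>\<^sub>A (x \<star>\<^sub>A z)) \<circ>\<^sub>A (u \<star>\<^sub>A y))"
    by (simp add: mult_minus_left mult_add_left mult_diff_left mult_scale_left star_circ')
  \<comment> \<open>Right anticommutativity brings the two copies of \<open>u\<close> together, so
    that \<open>circ_star_diag\<close> applies.\<close>
  also have "\<dots> = (u \<circ>\<^sub>A (u \<star>\<^sub>A y)) \<circ>\<^sub>A (x \<star>\<^sub>A z)"
    using right_anticomm'[of u "x \<star>\<^sub>A z"] by simp
  also have "\<dots> = 0"
    by (simp add: circ_star_diag mult_minus_left mult_scale_left star_circ')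
  finally show ?thesis .
qed

lemma Kantor_product_eq:
  "Kantor_product u star circ x y =
     u \<star>\<^sub>A (x \<circ>\<^sub>A y) + u \<star>\<^sub>A (x \<circ>\<^sub>A y) - x \<circ>\<^sub>A (u \<star>\<^sub>A y)"
  by (simp add: Kantor_product_def star_circ')

text \<open>After expansion, \<open>(x \<circ> (u \<star> y)) \<circ> (u \<star> z)\<close> vanishes
  by \<open>circ_star_circ_star_diag\<close>; every other term contains a product covered by
  \<open>star_circ_circ\<close>.\<close>

lemma Kantor_product_Kantor_product_left:
  "Kantor_product u star circ (Kantor_product u star circ x y) z = 0"
proof -
  have "(x \<circ>\<^sub>A (u \<star>\<^sub>A y)) \<circ>\<^sub>A z = - ((x \<circ>\<^sub>A z) \<circ>\<^sub>A (u \<star>\<^sub>A y))"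
    by (rule right_anticomm')
  then show ?thesis
    by (simp add: Kantor_product_eq mult_add_left mult_diff_left star_circ'
        star.mult_add_right star.mult_diff_right star.mult_minus_right)
qed

text \<open>Left multiplication by \<open>u\<close> kills the inner Kantor product, by
  \<open>star_star_circ\<close> and \<open>star_circ_star_diag\<close>; the latter also removes
  \<open>u \<star> (x \<circ> (u \<star> (y \<circ> z)))\<close>.\<close>

lemma Kantor_product_Kantor_product_right:
  "Kantor_product u star circ x (Kantor_product u star circ y z) =
     - (u \<star>\<^sub>A (x \<circ>\<^sub>A (y \<circ>\<^sub>A (u \<star>\<^sub>A z))) + u \<star>\<^sub>A (x \<circ>\<^sub>A (y \<circ>\<^sub>A (u \<star>\<^sub>A z))))"
  by (simp add: Kantor_product_eq mult_add_right mult_diff_right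
      star.mult_add_right star.mult_diff_right)

lemma star_circ_circ_antisym:
  "u \<star>\<^sub>A (x \<circ>\<^sub>A (y \<circ>\<^sub>A w)) + u \<star>\<^sub>A (y \<circ>\<^sub>A (x \<circ>\<^sub>A w)) = 0"
  using arg_cong[OF delta_identity[of x y w], of "star u"]
  by (simp add: star.mult_add_right star.mult_scale_right)

lemma mock_Novikov_algebra_Kantor_product:
  "mock_Novikov_algebra scale (Kantor_product u star circ) \<delta>"
proof -
  interpret K: complex_algebra scale "Kantor_product u star circ"
    by (intro complex_algebra_Kantor_product star.complex_algebra_axioms complex_algebra_axioms)
  show ?thesis
  proof unfold_locales
    fix a b c
    have "u \<star>\<^sub>A (b \<circ>\<^sub>A (a \<circ>\<^sub>A (u \<star>\<^sub>A c))) = - (u \<star>\<^sub>A (a \<circ>\<^sub>A (b \<circ>\<^sub>A (u \<star>\<^sub>A c))))"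
      using star_circ_circ_antisym[of u b a "u \<star>\<^sub>A c"] by (simp add: eq_neg_iff_add_eq_0)
    then show "\<delta> *s Kantor_product u star circ (Kantor_product u star circ a b) c
        + \<delta> *s Kantor_product u star circ (Kantor_product u star circ b a) c
        + Kantor_product u star circ a (Kantor_product u star circ b c)
        + Kantor_product u star circ b (Kantor_product u star circ a c) = 0"
      by (simp add: Kantor_product_Kantor_product_left Kantor_product_Kantor_product_right)
  qed (simp add: Kantor_product_Kantor_product_left)
qed

end

theorem theorem6p5:
  fixes scale :: "complex \<Rightarrow> 'a::ab_group_add \<Rightarrow> 'a"
    and star circ :: "'a \<Rightarrow> 'a \<Rightarrow> 'a"
    and \<delta> :: complex and u :: 'a
  assumes "\<delta> \<noteq> 0"
    and "mock_Novikov_Poisson_algebra scale star circ \<delta>"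
  defines "\<kappa> \<equiv> Kantor_product u star circ"
  shows "mock_Novikov_algebra scale \<kappa> \<delta> \<and> (\<forall>x y z. \<kappa> (\<kappa> x y) z = 0)"
proof -
  interpret mock_Novikov_Poisson_algebra scale star circ \<delta> by fact
  show ?thesis
    unfolding \<kappa>_def
    using mock_Novikov_algebra_Kantor_product Kantor_product_Kantor_product_left by blast
qed

end
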